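(* Let $q=2^d$ with $d$ a positive integer, $V=\mathrm{GF}(q^2)^2$, $\langle w\rangle\cong C_{q^2}$, and $G=\langle w\rangle\times(V,+)$. Let $\phi$ be the order $2$ automorphism of $G$ given by $(w^i,(x,y))^\phi:=(w^{-i},(x^q,y^q))$. Let $\beta\in\mathrm{GF}(q^2)\setminus\mathrm{GF}(q)$, and let $B\subset V$ be a subset such that $B\cup\{(\beta,0)\}$ is a $\mathrm{GF}(2)$-basis for $V$. Then the subgroup $$\mathcal{G}:=\langle(\phi,1,\beta,0),\ (1,w,0,0),\ (1,1,s,t) : (s,t)\in B\rangle$$ of $\langle\phi\rangle\ltimes G$ is a nonabelian group containing a $(q^4,q^2,q^4,q^2)$-relative difference set.
   Context: A subset $R$ of a finite group $G$ is an $(m,u,k,\lambda)$-relative difference set, relative to a subgroup $U\le G$ of order $u$ (the forbidden subgroup), if $|R|=k$, $|G|=mu$, and the collection $\{r_1r_2^{-1} : r_1\ne r_2\in R\}$, counted with multiplicity, contains each element of $G\setminus U$ exactly $\lambda$ times and contains no element of $U$. A group contains an $(m,u,k,\lambda)$-relative difference set if it does so relative to some subgroup of order $u$. Elements of $\langle\phi\rangle\ltimes G$ are written as $(a,b,c,e)$ with $a\in\langle\phi\rangle$, $b\in\langle w\rangle$, $(c,e)\in V$, standing for the pair $(a,(b,(c,e)))$. Automorphisms act on the right and multiplication of pairs is $(\alpha,g)(\alpha',h)=(\alpha\alpha',\ g^{\alpha'}h)$ for $\alpha,\alpha'\in\langle\phi\rangle$ and $g,h\in G$, where $G$ is the direct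 product of the multiplicative group $\langle w\rangle$ and the additive group $V$.
   Formalization: The formal theorem also assumes that (β,0) is not in B and that the GF(2)-span of B is invariant under (x,y)↦(x^q,y^q); otherwise 𝒢 is all of ⟨φ⟩⋉G, of order 2q^6 instead of the required q^6, and the claim is false. *)

theory Defs
  imports
    "HOL-Algebra.Algebra"
    "HOL-Algebra.Algebraic_Closure_Type"
    "HOL-Library.Product_Plus"
    "HOL-Library.Z2"
begin

text \<open>The number of pairs, not just their existence, is counted: this is the multiplicity of \<open>g\<close>
  in the collection of quotients.\<close>

definition quotient_count :: "('g, 'e) monoid_scheme \<Rightarrow> 'g set \<Rightarrow> 'g \<Rightarrow> nat" where
  "quotient_count G R g =
     card {(r1, r2) \<in> R \<times> R. r1 \<noteq> r2 \<and> r1 \<otimes>\<^bsub>G\<^esub> inv\<^bsub>G\<^esub> r2 = g}"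

definition rel_diff_set ::
    "('g, 'e) monoid_scheme \<Rightarrow> nat \<Rightarrow> nat \<Rightarrow> nat \<Rightarrow> nat \<Rightarrow> 'g set \<Rightarrow> 'g set \<Rightarrow> bool" where
  "rel_diff_set G m u k l U R \<longleftrightarrow>
     group G \<and> finite (carrier G) \<and> subgroup U G \<and> card U = u \<and>
     R \<subseteq> carrier G \<and> card R = k \<and> Coset.order G = m * u \<and>
     (\<forall>g \<in> carrier G - U. quotient_count G R g = l) \<and>
     (\<forall>g \<in> U. quotient_count G R g = 0)"

definition contains_rel_diff_set ::
    "('g, 'e) monoid_scheme \<Rightarrow> nat \<Rightarrow> nat \<Rightarrow> nat \<Rightarrow> nat \<Rightarrow> bool" where
  "contains_rel_diff_set G m u k l \<longleftrightarrow> (\<exists>U R. rel_diff_set G m u k l U R)"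

text \<open>Automorphisms act on the right, so the product \<open>\<alpha>\<alpha>'\<close> means first \<open>\<alpha>\<close>, then \<open>\<alpha>'\<close>; this is
  the opposite of the composition order used by \<^const>\<open>AutoGroup\<close>.\<close>

definition right_AutoGroup :: "('g, 'e) monoid_scheme \<Rightarrow> ('g \<Rightarrow> 'g) monoid" where
  "right_AutoGroup G =
     (AutoGroup G)\<lparr>monoid.mult := \<lambda>\<alpha> \<alpha>'. \<alpha>' \<otimes>\<^bsub>AutoGroup G\<^esub> \<alpha>\<rparr>"

text \<open>\<open>A \<ltimes> G\<close> for a set \<open>A\<close> of automorphisms forming a subgroup of \<open>Aut(G)\<close>;
  \<open>\<alpha>' g\<close> below is \<open>g\<^sup>\<alpha>\<^sup>'\<close>.\<close>

definition semidirect ::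
    "('g \<Rightarrow> 'g) set \<Rightarrow> ('g, 'e) monoid_scheme \<Rightarrow> (('g \<Rightarrow> 'g) \<times> 'g) monoid" where
  "semidirect A G =
     \<lparr>carrier = A \<times> carrier G,
      monoid.mult = \<lambda>(\<alpha>, g) (\<alpha>', h). (\<alpha> \<otimes>\<^bsub>right_AutoGroup G\<^esub> \<alpha>', \<alpha>' g \<otimes>\<^bsub>G\<^esub> h),
      one = (\<one>\<^bsub>right_AutoGroup G\<^esub>, \<one>\<^bsub>G\<^esub>)\<rparr>"

definition vec_group :: "('a::field \<times> 'a) monoid" where
  "vec_group = \<lparr>carrier = UNIV, monoid.mult = (+), one = 0\<rparr>"

text \<open>Scalar multiplication by \<open>GF(2)\<close>, represented by the field \<^typ>\<open>bit\<close>. It is a vector space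
  structure if the field \<^typ>\<open>'a\<close> has characteristic two.\<close>

definition bit_scale :: "bit \<Rightarrow> 'a::field \<times> 'a \<Rightarrow> 'a \<times> 'a" where
  "bit_scale c v = (if c = 1 then v else 0)"

definition GF2_basis :: "('a::field \<times> 'a) set \<Rightarrow> bool" where
  "GF2_basis S \<longleftrightarrow> \<not> module.dependent bit_scale S \<and> module.span bit_scale S = UNIV"

definition frob :: "nat \<Rightarrow> 'a::field \<times> 'a \<Rightarrow> 'a \<times> 'a" where
  "frob q = (\<lambda>(x, y). (x ^ q, y ^ q))"

text \<open>In what follows \<open>W\<close> is the multiplicative cyclic group generated by \<open>w\<close>, so that
  \<open>w\<^sup>i \<mapsto> w\<^sup>-\<^sup>i\<close> is inversion in \<open>W\<close>. Like all elements of \<^const>\<open>AutoGroup\<close>, \<open>\<phi>\<close> must be extensional.\<close>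

definition ambient :: "('w, 'e) monoid_scheme \<Rightarrow> ('w \<times> ('a::field \<times> 'a)) monoid" where
  "ambient W = W \<times>\<times> vec_group"

definition phi ::
    "('w, 'e) monoid_scheme \<Rightarrow> nat \<Rightarrow> 'w \<times> ('a::field \<times> 'a) \<Rightarrow> 'w \<times> ('a \<times> 'a)" where
  "phi W q = (\<lambda>(b, v) \<in> carrier (ambient W). (inv\<^bsub>W\<^esub> b, frob q v))"

definition phi_semidirect ::
    "('w, 'e) monoid_scheme \<Rightarrow> nat \<Rightarrow>
     (('w \<times> ('a::field \<times> 'a) \<Rightarrow> 'w \<times> ('a \<times> 'a)) \<times> ('w \<times> ('a \<times> 'a))) monoid" where
  "phi_semidirect W q =
     semidirect (generate (right_AutoGroup (ambient W)) {phi W q}) (ambient W)"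

definition calG_set ::
    "('w, 'e) monoid_scheme \<Rightarrow> nat \<Rightarrow> 'w \<Rightarrow> 'a::field \<Rightarrow> ('a \<times> 'a) set \<Rightarrow>
     (('w \<times> ('a \<times> 'a) \<Rightarrow> 'w \<times> ('a \<times> 'a)) \<times> ('w \<times> ('a \<times> 'a))) set" where
  "calG_set W q w \<beta> B =
     generate (phi_semidirect W q)
       ({(phi W q, (\<one>\<^bsub>W\<^esub>, (\<beta>, 0))),
         (\<one>\<^bsub>right_AutoGroup (ambient W)\<^esub>, (w, (0, 0)))} \<union>
        {(\<one>\<^bsub>right_AutoGroup (ambient W)\<^esub>, (\<one>\<^bsub>W\<^esub>, (s, t))) | s t. (s, t) \<in> B})"

text \<open>The statement is meant for \<open>B\<close> not containing \<open>(\<beta>, 0)\<close> and with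
  \<open>(x, y) \<mapsto> (x\<^sup>q, y\<^sup>q)\<close>-invariant span. If \<open>B \<union> {(\<beta>, 0)}\<close> is a basis but the span of \<open>B\<close> is not mapped to itself by
  \<open>(x, y) \<mapsto> (x\<^sup>q, y\<^sup>q)\<close>, or if \<open>(\<beta>, 0) \<in> B\<close>, then \<open>calG_set W q w \<beta> B\<close> contains
  \<open>(1, 1, v)\<close> for all \<open>v \<in> V\<close>, because conjugation by \<open>(\<phi>, 1, \<beta>, 0)\<close> maps \<open>(1, 1, s, t)\<close> to
  \<open>(1, 1, s\<^sup>q, t\<^sup>q)\<close>. It is then the whole of \<open>\<langle>\<phi>\<rangle> \<ltimes> G\<close>, whose order is twice
  the order \<open>q\<^sup>4 q\<^sup>2\<close> that a group with a \<open>(q\<^sup>4, q\<^sup>2, q\<^sup>4, q\<^sup>2)\<close>-relative difference set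
  must have. Both conditions, which are not spelled out in the source, are therefore necessary.\<close>

definition calG ::
    "('w, 'e) monoid_scheme \<Rightarrow> nat \<Rightarrow> 'w \<Rightarrow> 'a::field \<Rightarrow> ('a \<times> 'a) set \<Rightarrow>
     (('w \<times> ('a \<times> 'a) \<Rightarrow> 'w \<times> ('a \<times> 'a)) \<times> ('w \<times> ('a \<times> 'a))) monoid" where
  "calG W q w \<beta> B = (phi_semidirect W q)\<lparr>carrier := calG_set W q w \<beta> B\<rparr>"

end

theory Submission
  imports Defs
begin

text \<open>The set to look at first is a relative difference set in the abelian group \<open>W \<times> V\<close>. The
  \<open>q\<^sup>2 + 1\<close> members of a spread of \<open>V\<close> are subgroups of order \<open>q\<^sup>2\<close> that meet
  pairwise in \<open>0\<close>. Leave out one member \<open>L\<close>, label the others as \<open>L\<^sub>b\<close> by the elements \<open>b\<close> of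
  \<open>W\<close>, and let \<open>D\<close> be the union of the sets \<open>{b} \<times> L\<^sub>b\<close>. For \<open>b \<noteq> b'\<close> the sums
  \<open>L\<^sub>b + L\<^sub>b\<^sub>'\<close> cover \<open>V\<close> once, and the \<open>L\<^sub>b\<close> without \<open>0\<close> together cover \<open>V - L\<close>
  once. Hence \<open>D\<close> is a relative difference set with forbidden subgroup \<open>{1} \<times> L\<close>, for every
  labelling (\<open>card_spread_translate_intersection\<close>).

  The labelling can be chosen so that \<open>\<phi>\<close> maps \<open>D\<close> to the translate \<open>w\<^sup>-\<^sup>1 D\<close>. On \<open>V\<close> the map
  \<open>(x, y) \<mapsto> (x\<^sup>q, y\<^sup>q)\<close> is an involution whose fixed space has order \<open>q\<^sup>2\<close>, and there
  are coordinates \<open>(T, U)\<close> on \<open>V\<close> with values in the field in which it becomes the transvection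
  \<open>(T, U) \<mapsto> (T, U + T)\<close> (\<open>transvection_coordinates\<close>). In these coordinates take the lines
  \<open>U = a T\<close>, and for \<open>L\<close> the line \<open>T = 0\<close>, which is the fixed space. The transvection takes the
  line of slope \<open>a\<close> to the line of slope \<open>a + 1\<close>, so it moves all lines except \<open>L\<close>. The map
  \<open>b \<mapsto> w b\<^sup>-\<^sup>1\<close> of \<open>W\<close> has no fixed points either, since a generator of a cyclic group of even
  order is not a square. Both are involutions without fixed points on sets of \<open>q\<^sup>2\<close> elements, so
  some bijection \<open>f\<close> from \<open>W\<close> to the slopes intertwines them (\<open>cyclic_reflection_labelling\<close>).
  Labelling by \<open>f\<close> gives the translate.

  Since the span \<open>H\<close> of \<open>B\<close> is a hyperplane invariant under \<open>\<phi>\<close>, the group generated in the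
  statement has exactly one element \<open>(\<alpha>, g)\<close> over each \<open>g = (b, v)\<close> in \<open>W \<times> V\<close>, with \<open>\<alpha> = 1\<close> if
  \<open>v \<in> H\<close> and \<open>\<alpha> = \<phi>\<close> otherwise (\<open>calG_set_eq_lift\<close>). Right multiplication by such an element acts
  on the second components as \<open>\<alpha>\<close> followed by a translation, and so takes \<open>D\<close> to one of its translates.
  For \<open>R\<close> the lift of \<open>D\<close>, the number of \<open>r \<in> R\<close> with \<open>r x \<in> R\<close> is therefore again the size of an
  intersection of two translates of \<open>D\<close>. This number counts quotients of the form \<open>r\<^sup>-\<^sup>1 s\<close>, so the
  relative difference set is not \<open>R\<close> but the set of the inverses of its elements
  (\<open>quotient_count_inverses\<close>). The forbidden subgroup is the lift of \<open>{1} \<times> L\<close>: each \<open>v \<in> L\<close> has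
  the form \<open>z + \<phi>(z)\<close>, hence lies in the invariant hyperplane \<open>H\<close> (\<open>fixed_space_subset\<close>). The group
  is not abelian because \<open>\<phi>\<close> inverts \<open>w\<close>, whose order is greater than \<open>2\<close>.\<close>

section \<open>Quotients and right multiplication\<close>

text \<open>A pair \<open>(r, r x)\<close> in \<open>R\<close> gives the pair of inverses whose quotient is \<open>x\<close>, and every such pair of
  inverses arises this way. This replaces quotients by the effect of right multiplication on \<open>R\<close>, which
  is easy to describe in a semidirect product with automorphisms acting on the right.\<close>

lemma (in group) quotient_count_inverses:
  assumes R: "R \<subseteq> carrier G" "finite R" and x: "x \<in> carrier G" "x \<noteq> \<one>"
  shows "quotient_count G (m_inv G ` R) x = card {r \<in> R. r \<otimes> x \<in> R}"
proof -
  have "bij_betw (\<lambda>r. (inv r, inv (r \<otimes> x))) {r \<in> R. r \<otimes> x \<in> R}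
     {(r1, r2) \<in> m_inv G ` R \<times> m_inv G ` R. r1 \<noteq> r2 \<and> r1 \<otimes> inv r2 = x}"
    (is "bij_betw ?h ?A ?B")
  proof (rule bij_betw_imageI)
    show "inj_on ?h ?A"
      using inj_on_subset[OF inv_inj, of ?A] R(1) by (auto simp: inj_on_def)
    show "?h ` ?A = ?B"
    proof
      show "?h ` ?A \<subseteq> ?B"
      proof
        fix p assume "p \<in> ?h ` ?A"
        then obtain r where r: "r \<in> R" "r \<otimes> x \<in> R" and p: "p = (inv r, inv (r \<otimes> x))"
          by auto
        have rc: "r \<in> carrier G" using r R(1) by auto
        have "inv r \<otimes> inv (inv (r \<otimes> x)) = x"
          using rc x by (simp flip: m_assoc)
        moreover have "inv r \<noteq> inv (r \<otimes> x)"
          using rc x by (metis inv_inv l_cancel_one' m_closed)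
        ultimately show "p \<in> ?B" using r p by auto
      qed
      show "?B \<subseteq> ?h ` ?A"
      proof
        fix p assume "p \<in> ?B"
        then obtain r s where r: "r \<in> R" "s \<in> R" "inv r \<otimes> inv (inv s) = x"
          and p: "p = (inv r, inv s)"
          by auto
        have rc: "r \<in> carrier G" "s \<in> carrier G" using r R(1) by auto
        then have "r \<otimes> x = s" using r(3) by (auto simp flip: m_assoc)
        then show "p \<in> ?h ` ?A" using r p by auto
      qed
    qed
  qed
  then show ?thesis
    unfolding quotient_count_def by (metis (lifting) bij_betw_same_card)
qed

section \<open>Involutions without fixed points\<close>

text \<open>Both sets split into orbits of size two, equally many, and any matching of the orbits will do.\<close>

lemma fixed_point_free_involutions_conjugate:
  assumes "finite A" "finite B" "card A = card B"
    and "\<And>a. a \<in> A \<Longrightarrow> i a \<in> A \<and> i a \<noteq> a \<and> i (i a) = a"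
    and "\<And>b. b \<in> B \<Longrightarrow> j b \<in> B \<and> j b \<noteq> b \<and> j (j b) = b"
  shows "\<exists>f. bij_betw f A B \<and> (\<forall>a\<in>A. f (i a) = j (f a))"
  using assms
proof (induction "card A" arbitrary: A B rule: less_induct)
  case less
  show ?case
  proof (cases "A = {}")
    case True
    then have "B = {}" using less.prems by auto
    then show ?thesis using True by (auto simp: bij_betw_def)
  next
    case False
    then obtain a b where a: "a \<in> A" and b: "b \<in> B"
      using less.prems(1-3) by (metis card_0_eq ex_in_conv)
    \<comment> \<open>Remove one orbit on each side and match the two removed orbits with each other.\<close>
    define A' where "A' = A - {a, i a}"
    define B' where "B' = B - {b, j b}"
    have ia: "i a \<in> A" "i a \<noteq> a" "i (i a) = a" using less.prems(4)[OF a] by auto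
    have jb: "j b \<in> B" "j b \<noteq> b" "j (j b) = b" using less.prems(5)[OF b] by auto
    have A: "A = A' \<union> {a, i a}" and B: "B = B' \<union> {b, j b}"
      using a b ia jb by (auto simp: A'_def B'_def)
    have cA: "card A' = card A - 2"
      unfolding A'_def using a ia less.prems(1) by (subst card_Diff_subset) auto
    have cB: "card B' = card B - 2"
      unfolding B'_def using b jb less.prems(2) by (subst card_Diff_subset) auto
    have "card {a, i a} \<le> card A"
      using a ia less.prems(1) by (intro card_mono) auto
    then have lt: "card A' < card A"
      using cA ia by auto
    have iA': "i x \<in> A' \<and> i x \<noteq> x \<and> i (i x) = x" if "x \<in> A'" for x
      using that less.prems(4)[of x] less.prems(4)[OF a] unfolding A'_def by auto
    have jB': "j x \<in> B' \<and> j x \<noteq> x \<and> j (j x) = x" if "x \<in> B'" for x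
      using that less.prems(5)[of x] less.prems(5)[OF b] unfolding B'_def by auto
    have "\<exists>f. bij_betw f A' B' \<and> (\<forall>a\<in>A'. f (i a) = j (f a))"
      by (rule less.hyps[OF lt]) (use less.prems cA cB iA' jB' in \<open>auto simp: A'_def B'_def\<close>)
    then obtain f where f: "bij_betw f A' B'" "\<forall>a\<in>A'. f (i a) = j (f a)"
      by auto
    define g where "g = f(a := b, i a := j b)"
    have "bij_betw g A' B'"
      using f(1) by (subst bij_betw_cong[of A' g f]) (auto simp: g_def A'_def)
    moreover have "bij_betw g {a, i a} {b, j b}"
      using ia jb by (auto simp: bij_betw_def inj_on_def g_def)
    ultimately have "bij_betw g A B"
      unfolding A B by (rule bij_betw_combine) (auto simp: B'_def)
    moreover have "g (i x) = j (g x)" if "x \<in> A" for x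
    proof (cases "x \<in> A'")
      case True
      then have "i x \<in> A'" using iA' by auto
      with True f(2) show ?thesis by (auto simp: g_def A'_def)
    next
      case False
      with that ia jb show ?thesis by (auto simp: A g_def)
    qed
    ultimately show ?thesis by auto
  qed
qed

lemma (in group) comm_group_of_generator:
  assumes w: "w \<in> carrier G" and cyc: "carrier G = generate G {w}"
  shows "comm_group G"
proof -
  have "carrier G = range (\<lambda>n::int. w [^] n)"
    using generate_pow[OF w] cyc by auto
  then show ?thesis
    using w by (intro cyclic_imp_abelian_group) (unfold cyclic_group, blast)
qed

text \<open>If \<open>b\<^sup>2 = w\<close>, then \<open>w\<close> raised to half the group order is \<open>b\<close> raised to the group order, which is
  trivial, against the order of \<open>w\<close>.\<close>

lemma (in group) cyclic_even_generator_not_square: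
  assumes w: "w \<in> carrier G" and cyc: "carrier G = generate G {w}"
    and fin: "finite (carrier G)" and ev: "even (Coset.order G)" and b: "b \<in> carrier G"
  shows "b \<otimes> b \<noteq> w"
proof
  assume bw: "b \<otimes> b = w"
  have o: "ord w = Coset.order G"
    using generate_pow_card[OF w] cyc by (simp add: Coset.order_def)
  have "w [^] (Coset.order G div 2) = (b [^] (2::nat)) [^] (Coset.order G div 2)"
    using bw b by (simp add: numeral_2_eq_2)
  also have "\<dots> = b [^] Coset.order G"
    using b ev by (simp add: nat_pow_pow)
  also have "\<dots> = \<one>"
    using b by (rule pow_order_eq_1)
  finally have "Coset.order G dvd Coset.order G div 2"
    using w o by (simp add: pow_eq_id)
  moreover have "Coset.order G > 0" using fin by (simp add: order_gt_0_iff_finite)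
  ultimately show False using ev by (auto dest!: dvd_imp_le)
qed

text \<open>A fixed point of \<open>b \<mapsto> w b\<^sup>-\<^sup>1\<close> would be a square root of \<open>w\<close>. The factor \<open>w\<close> is essential: inversion
  alone fixes the identity and could not be matched with an involution that has no fixed points.\<close>

lemma (in group) cyclic_reflection_labelling:
  fixes A :: "'c set"
  assumes w: "w \<in> carrier G" and cyc: "carrier G = generate G {w}"
    and fin: "finite (carrier G)" and ev: "even (Coset.order G)"
    and A: "finite A" "card A = Coset.order G"
    and j: "\<And>a. a \<in> A \<Longrightarrow> j a \<in> A \<and> j a \<noteq> a \<and> j (j a) = a"
  obtains f where "bij_betw f (carrier G) A" "\<And>b. b \<in> carrier G \<Longrightarrow> f (w \<otimes> inv b) = j (f b)"
proof -
  have "\<exists>f. bij_betw f (carrier G) A \<and> (\<forall>b\<in>carrier G. f (w \<otimes> inv b) = j (f b))"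
  proof (rule fixed_point_free_involutions_conjugate[OF fin A(1)])
    show "card (carrier G) = card A" using A by (simp add: Coset.order_def)
    fix b assume b: "b \<in> carrier G"
    interpret comm_group G by (rule comm_group_of_generator[OF w cyc])
    have "w \<otimes> inv b \<noteq> b"
      using cyclic_even_generator_not_square[OF w cyc fin ev b] b w by (metis inv_solve_right')
    moreover have "w \<otimes> inv (w \<otimes> inv b) = b"
      using b w by (simp add: inv_mult_group m_lcomm)
    ultimately show "w \<otimes> inv b \<in> carrier G \<and> w \<otimes> inv b \<noteq> b \<and> w \<otimes> inv (w \<otimes> inv b) = b"
      using b w by auto
  qed (use j in auto)
  then show ?thesis using that by auto
qed

section \<open>The Frobenius involution in transvection coordinates\<close>

text \<open>Translation by \<open>1\<close> permutes the ring, so it does not change the sum of all elements.\<close>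

lemma of_nat_card_UNIV_eq_0: "of_nat (card (UNIV :: 'a set)) = (0 :: 'a::{comm_ring_1, finite})"
proof -
  have "(\<Sum>x\<in>UNIV. x) = (\<Sum>x\<in>UNIV. x + (1::'a))"
    by (rule sum.reindex_bij_witness[of _ "\<lambda>x. x + 1" "\<lambda>x. x - 1"]) auto
  then show ?thesis by (simp add: sum.distrib)
qed

lemma finite_field_power_card:
  fixes x :: "'a::{field, finite}"
  shows "x ^ card (UNIV :: 'a set) = x"
proof (cases "x = 0")
  case True
  then show ?thesis by (simp add: power_0_left)
next
  case False
  define K where "K = (ring_of_type_algebra :: 'a ring)"
  interpret field K unfolding K_def by (rule field_from_type_algebra)
  interpret M: group "Multiplicative_Group.mult_of K" by (rule field_mult_group)
  have carr: "carrier (Multiplicative_Group.mult_of K) = UNIV - {0}"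
    by (simp add: K_def ring_of_type_algebra_def)
  have pow: "y [^]\<^bsub>Multiplicative_Group.mult_of K\<^esub> n = y ^ n" for y :: 'a and n :: nat
    by (induction n) (simp_all add: K_def ring_of_type_algebra_def nat_pow_def mult.commute)
  have "Coset.order (Multiplicative_Group.mult_of K) = card (UNIV :: 'a set) - 1"
    by (simp only: Coset.order_def carr) (simp add: card_Diff_subset)
  then have "x ^ (card (UNIV :: 'a set) - 1) = 1"
    using M.pow_order_eq_1[of x] False carr pow by (simp add: K_def ring_of_type_algebra_def)
  then show ?thesis
    by (subst power_eq_if) simp
qed

text \<open>The field with \<open>q\<^sup>2\<close> elements in characteristic two, with \<open>x \<mapsto> x\<^sup>q\<close> as its involutory automorphism.
  Additivity of this map stands in for \<open>q\<close> being a power of two, because the arguments concern the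
  automorphism and not the exponent.\<close>

locale quadratic_frobenius =
  fixes q :: nat
  assumes q_gt_1: "q > 1"
    and card_field: "card (UNIV :: 'a::{field, finite} set) = q ^ 2"
    and two_eq_0: "(2 :: 'a) = 0"
    and power_q_add: "(x + y) ^ q = x ^ q + (y :: 'a) ^ q"
begin

lemma power_q_power_q: "((x :: 'a) ^ q) ^ q = x"
  using finite_field_power_card[of x] by (simp add: card_field power2_eq_square power_mult)

lemma add_self [simp]: "(x :: 'a) + x = 0"
  using two_eq_0 mult_2[of x] by simp

lemma add_self_left [simp]: "(x :: 'a) + (x + y) = y"
  by (simp flip: add.assoc)

lemma uminus_eq [simp]: "- (x :: 'a) = x"
  by (simp add: minus_unique)

lemma diff_eq [simp]: "(x :: 'a) - y = x + y"
  using add_uminus_conv_diff[of x y] by simp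

lemma vec_add_self [simp]: "v + v = (0 :: 'a \<times> 'a)"
  by (cases v) (simp add: zero_prod_def)

lemma vec_add_self_left [simp]: "v + (v + z) = (z :: 'a \<times> 'a)"
  by (simp flip: add.assoc)

text \<open>Since \<open>x\<^sup>q = x\<close> has at most \<open>q\<close> solutions, some \<open>x\<close> has nonzero trace \<open>t = x + x\<^sup>q\<close>. The trace is
  fixed by the automorphism, so dividing \<open>x\<close> by it gives an element of trace \<open>1\<close>.\<close>

lemma trace_one: obtains \<gamma> :: 'a where "\<gamma> ^ q = \<gamma> + 1"
proof -
  let ?p = "monom 1 q - [:0, 1 :: 'a:]"
  have deg: "degree ?p = q"
    using q_gt_1 by (intro antisym degree_diff_le le_degree) (auto simp: degree_monom_eq coeff_pCons split: nat.splits)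
  have p0: "?p \<noteq> 0" using deg q_gt_1 by auto
  have "card {x :: 'a. poly ?p x = 0} \<le> q"
    using card_poly_roots_bound[OF p0] unfolding deg .
  moreover have "{x :: 'a. poly ?p x = 0} = {x. x ^ q = x}"
    by (simp add: poly_monom del: diff_eq)
  moreover have "q < card (UNIV :: 'a set)"
    using q_gt_1 by (simp add: card_field power2_eq_square)
  ultimately have "{x :: 'a. x ^ q = x} \<noteq> UNIV" by auto
  then obtain x :: 'a where x: "x ^ q \<noteq> x" by auto
  define t where "t = x + x ^ q"
  have xq: "x ^ q = x + t" by (simp add: t_def)
  then have "t \<noteq> 0" using x by auto
  moreover have "t ^ q = t" by (simp add: t_def power_q_add power_q_power_q add.commute)
  ultimately have "(x / t) ^ q = x / t + 1"
    by (simp add: power_divide xq add_divide_distrib)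
  then show ?thesis using that by blast
qed

lemma frob_add: "frob q (v + v') = frob q v + (frob q v' :: 'a \<times> 'a)"
  by (simp add: frob_def case_prod_beta power_q_add)

lemma frob_frob: "frob q (frob q v) = (v :: 'a \<times> 'a)"
  by (simp add: frob_def case_prod_beta power_q_power_q)

text \<open>Over the fixed field \<open>K\<^sub>0\<close> of \<open>x \<mapsto> x\<^sup>q\<close> the field is \<open>K\<^sub>0 \<oplus> \<gamma> K\<^sub>0\<close> with \<open>\<gamma>\<^sup>q = \<gamma> + 1\<close>. An element
  \<open>x\<close> with trace \<open>t\<close> is \<open>(x + \<gamma> t) + \<gamma> t\<close> with both \<open>t\<close> and \<open>x + \<gamma> t\<close> in \<open>K\<^sub>0\<close>, and the
  automorphism adds \<open>t\<close> to the first of them. So the pairs \<open>(x + \<gamma> t, t)\<close> already show the automorphism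
  as a transvection over \<open>K\<^sub>0\<close>. Packing the two traces of a vector \<open>(x, y)\<close> into one field element by
  \<open>(a, b) \<mapsto> a + \<gamma> b\<close>, and likewise the two remaining components, gives \<open>T\<close> and \<open>U\<close>.\<close>

lemma transvection_coordinates:
  obtains T U :: "'a \<times> 'a \<Rightarrow> 'a" where
    "\<And>v v'. T (v + v') = T v + T v'" "\<And>v v'. U (v + v') = U v + U v'"
    "bij (\<lambda>v. (T v, U v))"
    "\<And>v. T (frob q v) = T v" "\<And>v. U (frob q v) = U v + T v"
proof -
  obtain \<gamma> :: 'a where \<gamma>: "\<gamma> ^ q = \<gamma> + 1" by (rule trace_one)
  define tr :: "'a \<Rightarrow> 'a" where "tr = (\<lambda>x. x + x ^ q)"
  define T :: "'a \<times> 'a \<Rightarrow> 'a" where "T = (\<lambda>(x, y). tr x + \<gamma> * tr y)"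
  define U :: "'a \<times> 'a \<Rightarrow> 'a"
    where "U = (\<lambda>(x, y). (x + \<gamma> * tr x) + \<gamma> * (y + \<gamma> * tr y))"
  have tr_add: "tr (x + y) = tr x + tr y" for x y
    by (simp add: tr_def power_q_add add_ac)
  have tr_frob: "tr (x ^ q) = tr x" for x
    by (simp add: tr_def power_q_power_q add.commute)
  have tr_fixed: "tr x ^ q = tr x" for x
    by (simp add: tr_def power_q_power_q power_q_add add.commute)
  have frob_tr: "x ^ q = x + tr x" for x
    by (simp add: tr_def)
  \<comment> \<open>\<open>1\<close> and \<open>\<gamma>\<close> are independent over the fixed field of \<open>x \<mapsto> x\<^sup>q\<close>.\<close>
  have indep: "x = 0 \<and> y = 0" if "x ^ q = x" "y ^ q = y" "x + \<gamma> * y = 0" for x y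
  proof -
    have "(x + \<gamma> * y) ^ q = x + \<gamma> * y + y"
      by (simp add: power_q_add power_mult_distrib that(1,2) \<gamma> algebra_simps)
    then have "y = 0" using that(3) q_gt_1 by (simp add: power_0_left)
    then show ?thesis using that(3) by simp
  qed
  have T_add: "T (v + v') = T v + T v'" for v v'
    by (cases v; cases v') (simp add: T_def tr_add algebra_simps)
  have U_add: "U (v + v') = U v + U v'" for v v'
    by (cases v; cases v') (simp add: U_def tr_add algebra_simps)
  have T_frob: "T (frob q v) = T v" for v
    by (cases v) (simp add: T_def frob_def tr_frob)
  have U_frob: "U (frob q v) = U v + T v" for v
    by (cases v) (simp add: U_def T_def frob_def tr_frob, simp add: frob_tr algebra_simps)
  have kernel: "v = 0" if "T v = 0" "U v = 0" for v
  proof (cases v)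
    case (Pair x y)
    have "tr x = 0 \<and> tr y = 0"
      using that(1) by (intro indep) (simp_all add: T_def Pair tr_fixed)
    moreover from this have "x = 0 \<and> y = 0"
      using that(2) by (intro indep) (simp_all add: U_def Pair frob_tr)
    ultimately show ?thesis by (simp add: Pair zero_prod_def)
  qed
  have "inj (\<lambda>v. (T v, U v))"
  proof (rule injI)
    fix v v' assume eq: "(T v, U v) = (T v', U v')"
    have "v + v' = 0" using eq by (intro kernel) (simp_all add: T_add U_add)
    moreover have "v + (v + v') = v'" by simp
    ultimately show "v = v'" by simp
  qed
  then have "bij (\<lambda>v. (T v, U v))"
    by (simp add: finite_UNIV_inj_surj bij_def)
  then show ?thesis using that T_add U_add T_frob U_frob by blast
qed

end

lemma quadratic_frobenius_two_power:
  assumes "d > 0" "q = 2 ^ d" "card (UNIV :: 'a::{field, finite} set) = q ^ 2"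
  shows "quadratic_frobenius TYPE('a) q"
proof
  show "q > 1" using one_less_power[of "2::nat" d] assms(1) unfolding assms(2) by auto
  have "(2 :: 'a) ^ (2 * d) = of_nat (card (UNIV :: 'a set))"
    by (simp add: assms(2,3) power_mult power2_eq_square flip: power_mult_distrib)
  then show two: "(2 :: 'a) = 0" by (simp add: of_nat_card_UNIV_eq_0)
  have sq: "(x + y)\<^sup>2 = x\<^sup>2 + y\<^sup>2" for x y :: 'a
    by (simp add: power2_sum two)
  show "(x + y) ^ q = x ^ q + y ^ q" for x y :: 'a
    unfolding assms(2)
  proof (induction d)
    case (Suc d)
    then show ?case by (simp only: power_Suc2 power_mult sq)
  qed simp
qed (rule assms)

section \<open>Intersections of translates of a union of spread lines\<close>

text \<open>The pair \<open>(b, t)\<close> stands for the point with group component \<open>b\<close> and coordinates \<open>(t, f b * t)\<close> on the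
  line labelled \<open>b\<close>, and the equation says that translation by \<open>(c, (t0, u0))\<close> takes this point to the line
  labelled \<open>b \<otimes> c\<close>. If \<open>c\<close> is not the identity, the two lines have different slopes and each \<open>b\<close> admits
  one \<open>t\<close>. If it is, the slope must be that of \<open>(t0, u0)\<close>, which determines \<open>b\<close> and leaves \<open>t\<close> free.\<close>

lemma (in group) card_spread_translate_intersection:
  fixes f :: "'a \<Rightarrow> 'f::{field, finite}"
  assumes f: "bij_betw f (carrier G) UNIV"
    and c: "c \<in> carrier G" and nz: "c \<noteq> \<one> \<or> t0 \<noteq> 0"
  shows "card {(b, t). b \<in> carrier G \<and> f b * t + u0 = f (b \<otimes> c) * (t + t0)} = card (UNIV :: 'f set)"
    (is "card ?S = _")
proof (cases "c = \<one>")
  case False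
  define h where "h = (\<lambda>b. (b, (f (b \<otimes> c) * t0 - u0) / (f b - f (b \<otimes> c))))"
  have "f b \<noteq> f (b \<otimes> c)" if "b \<in> carrier G" for b
    using inj_onD[OF bij_betw_imp_inj_on[OF f], of b "b \<otimes> c"] that c False by auto
  then have "?S = h ` carrier G"
    by (auto simp: h_def field_simps image_iff)
  moreover have "inj_on h (carrier G)" by (auto simp: h_def inj_on_def)
  ultimately show ?thesis
    using f by (simp add: card_image bij_betw_same_card)
next
  case True
  then have t0: "t0 \<noteq> 0" using nz by simp
  obtain b0 where b0: "b0 \<in> carrier G" "f b0 = u0 / t0"
    using f by (metis UNIV_I bij_betw_def imageE)
  have "b = b0 \<longleftrightarrow> u0 = f b * t0" if "b \<in> carrier G" for b
    using that b0 f t0 by (auto simp: bij_betw_def inj_on_def field_simps)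
  then have "?S = {b0} \<times> UNIV"
    using b0 t0 c by (auto simp: True algebra_simps)
  then show ?thesis by simp
qed

section \<open>Semidirect products with groups of automorphisms\<close>

lemma carrier_right_AutoGroup [simp]: "carrier (right_AutoGroup G) = auto G"
  by (simp add: right_AutoGroup_def AutoGroup_def)

lemma one_right_AutoGroup [simp]: "\<one>\<^bsub>right_AutoGroup G\<^esub> = (\<lambda>x\<in>carrier G. x)"
  by (simp add: right_AutoGroup_def AutoGroup_def BijGroup_def)

lemma mult_right_AutoGroup:
  assumes "\<alpha> \<in> auto G" "\<alpha>' \<in> auto G"
  shows "\<alpha> \<otimes>\<^bsub>right_AutoGroup G\<^esub> \<alpha>' = compose (carrier G) \<alpha>' \<alpha>"
  using assms by (simp add: right_AutoGroup_def AutoGroup_def BijGroup_def auto_def)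

lemma group_right_AutoGroup:
  assumes "group G"
  shows "group (right_AutoGroup G)"
proof -
  interpret A: group "AutoGroup G"
    by (rule group.AutoGroup[OF assms])
  have eq: "carrier (right_AutoGroup G) = carrier (AutoGroup G)"
    "\<one>\<^bsub>right_AutoGroup G\<^esub> = \<one>\<^bsub>AutoGroup G\<^esub>"
    "x \<otimes>\<^bsub>right_AutoGroup G\<^esub> y = y \<otimes>\<^bsub>AutoGroup G\<^esub> x" for x y
    by (simp_all add: right_AutoGroup_def)
  show ?thesis
    by (rule groupI) (auto simp only: eq A.m_assoc A.one_closed A.m_closed A.r_one intro: A.r_inv_ex)
qed

lemma group_semidirect:
  fixes G (structure)
  assumes "group G" "subgroup A (right_AutoGroup G)"
  shows "group (semidirect A G)"
proof -
  interpret group G by fact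
  interpret R: group "right_AutoGroup G" by (rule group_right_AutoGroup) fact
  interpret A: subgroup A "right_AutoGroup G" by fact
  have aut: "\<alpha> \<in> auto G" if "\<alpha> \<in> A" for \<alpha>
    using A.subset that by auto
  have closed: "\<alpha> g \<in> carrier G" if "\<alpha> \<in> A" "g \<in> carrier G" for \<alpha> g
    using aut[OF that(1)] that(2) by (auto simp: auto_def hom_def)
  have hom: "\<alpha> (g \<otimes> h) = \<alpha> g \<otimes> \<alpha> h"
    if "\<alpha> \<in> A" "g \<in> carrier G" "h \<in> carrier G" for \<alpha> g h
    using aut[OF that(1)] that(2,3) by (auto simp: auto_def hom_def)
  have comp: "(\<alpha> \<otimes>\<^bsub>right_AutoGroup G\<^esub> \<alpha>') g = \<alpha>' (\<alpha> g)"
    if "\<alpha> \<in> A" "\<alpha>' \<in> A" "g \<in> carrier G" for \<alpha> \<alpha>' g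
    using that by (simp add: mult_right_AutoGroup aut compose_def)
  have one: "\<one>\<^bsub>right_AutoGroup G\<^esub> g = g" if "g \<in> carrier G" for g
    using that by simp
  have sd: "carrier (semidirect A G) = A \<times> carrier G"
    "\<one>\<^bsub>semidirect A G\<^esub> = (\<one>\<^bsub>right_AutoGroup G\<^esub>, \<one>)"
    "(\<alpha>, g) \<otimes>\<^bsub>semidirect A G\<^esub> (\<alpha>', h) = (\<alpha> \<otimes>\<^bsub>right_AutoGroup G\<^esub> \<alpha>', \<alpha>' g \<otimes> h)"
    for \<alpha> \<alpha>' g h
    by (simp_all add: semidirect_def)
  have one_hom: "\<alpha> \<one> = \<one>" if "\<alpha> \<in> A" for \<alpha>
    using hom[OF that one_closed one_closed] closed[OF that one_closed] by simp
  show ?thesis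
  proof (rule groupI)
    fix x y assume "x \<in> carrier (semidirect A G)" "y \<in> carrier (semidirect A G)"
    then show "x \<otimes>\<^bsub>semidirect A G\<^esub> y \<in> carrier (semidirect A G)"
      by (cases x; cases y) (simp add: sd closed A.m_closed)
  next
    show "\<one>\<^bsub>semidirect A G\<^esub> \<in> carrier (semidirect A G)"
      using A.one_closed by (simp add: sd)
  next
    fix x y z
    assume "x \<in> carrier (semidirect A G)" "y \<in> carrier (semidirect A G)"
      "z \<in> carrier (semidirect A G)"
    then obtain \<alpha> g \<beta> h \<gamma> k where "x = (\<alpha>, g)" "y = (\<beta>, h)" "z = (\<gamma>, k)"
      "\<alpha> \<in> A" "\<beta> \<in> A" "\<gamma> \<in> A" "g \<in> carrier G" "h \<in> carrier G" "k \<in> carrier G"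
      by (auto simp: sd)
    then show "x \<otimes>\<^bsub>semidirect A G\<^esub> y \<otimes>\<^bsub>semidirect A G\<^esub> z =
        x \<otimes>\<^bsub>semidirect A G\<^esub> (y \<otimes>\<^bsub>semidirect A G\<^esub> z)"
      using A.mem_carrier by (simp add: sd comp hom closed m_assoc R.m_assoc del: carrier_right_AutoGroup)
  next
    fix x assume "x \<in> carrier (semidirect A G)"
    then obtain \<alpha> g where x: "x = (\<alpha>, g)" "\<alpha> \<in> A" "g \<in> carrier G"
      by (auto simp: sd)
    then show "\<one>\<^bsub>semidirect A G\<^esub> \<otimes>\<^bsub>semidirect A G\<^esub> x = x"
      using R.l_one[OF A.mem_carrier] by (simp add: sd one_hom del: one_right_AutoGroup)
    define \<alpha>' where "\<alpha>' = inv\<^bsub>right_AutoGroup G\<^esub> \<alpha>"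
    have \<alpha>': "\<alpha>' \<in> A" "\<alpha>' \<otimes>\<^bsub>right_AutoGroup G\<^esub> \<alpha> = \<one>\<^bsub>right_AutoGroup G\<^esub>"
      using x(2) A.mem_carrier unfolding \<alpha>'_def by (blast intro: R.l_inv)+
    have "\<alpha> (\<alpha>' (inv g)) = inv g"
      using comp[OF \<alpha>'(1) x(2), of "inv g"] one[of "inv g"] x(3) \<alpha>'(2) by simp
    then show "\<exists>y\<in>carrier (semidirect A G). y \<otimes>\<^bsub>semidirect A G\<^esub> x = \<one>\<^bsub>semidirect A G\<^esub>"
      using x \<alpha>' closed by (intro bexI[of _ "(\<alpha>', \<alpha>' (inv g))"]) (auto simp: sd simp del: one_right_AutoGroup)
  qed
qed

section \<open>The semidirect product with inversion and Frobenius\<close>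

text \<open>Commutativity of \<open>W\<close> makes inversion an automorphism, and hence \<open>\<phi>\<close> one of \<open>W \<times> V\<close>.\<close>

locale inversion_frobenius = quadratic_frobenius q + W: comm_group W
  for q :: nat and W :: "('w, 'e) monoid_scheme"
begin

abbreviation amb :: "('w \<times> 'a \<times> 'a) monoid" where "amb \<equiv> ambient W"

text \<open>The elements of \<open>\<langle>\<phi>\<rangle>\<close> are indexed by truth values, so that composition becomes exclusive or, and no
  case distinction on functions is needed.\<close>

definition phi_if :: "bool \<Rightarrow> 'w \<times> 'a \<times> 'a \<Rightarrow> 'w \<times> 'a \<times> 'a"
  where "phi_if x = (if x then phi W q else \<one>\<^bsub>right_AutoGroup amb\<^esub>)"

definition inv_if :: "bool \<Rightarrow> 'w \<Rightarrow> 'w" where "inv_if x b = (if x then inv\<^bsub>W\<^esub> b else b)"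

definition frob_if :: "bool \<Rightarrow> 'a \<times> 'a \<Rightarrow> 'a \<times> 'a" where "frob_if x v = (if x then frob q v else v)"

abbreviation SD
  where "SD \<equiv> phi_semidirect W q :: (('w \<times> 'a \<times> 'a \<Rightarrow> 'w \<times> 'a \<times> 'a) \<times> 'w \<times> 'a \<times> 'a) monoid"

lemma carrier_amb [simp]: "carrier amb = carrier W \<times> UNIV"
  by (simp add: ambient_def vec_group_def)

lemma mult_amb [simp]: "(b, v) \<otimes>\<^bsub>amb\<^esub> (c, z) = (b \<otimes>\<^bsub>W\<^esub> c, v + z)"
  by (simp add: ambient_def vec_group_def)

lemma one_amb [simp]: "\<one>\<^bsub>amb\<^esub> = (\<one>\<^bsub>W\<^esub>, 0)"
  by (simp add: ambient_def vec_group_def)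

lemma group_amb: "group amb"
proof (rule groupI)
  fix x assume "x \<in> carrier amb"
  then show "\<exists>y\<in>carrier amb. y \<otimes>\<^bsub>amb\<^esub> x = \<one>\<^bsub>amb\<^esub>"
    by (intro bexI[of _ "(inv\<^bsub>W\<^esub> fst x, snd x)"]) auto
qed (auto simp: W.m_assoc add.assoc)

lemma phi_if_apply: "b \<in> carrier W \<Longrightarrow> phi_if x (b, v) = (inv_if x b, frob_if x v)"
  by (simp add: phi_if_def phi_def inv_if_def frob_if_def)

lemma phi_if_ext: "phi_if x \<in> extensional (carrier amb)"
  by (auto simp: phi_if_def phi_def)

lemma inv_if_closed [simp]: "b \<in> carrier W \<Longrightarrow> inv_if x b \<in> carrier W"
  by (simp add: inv_if_def)

lemma inv_if_inv_if: "b \<in> carrier W \<Longrightarrow> inv_if y (inv_if x b) = inv_if (x \<noteq> y) b"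
  by (auto simp: inv_if_def)

lemma frob_if_frob_if: "frob_if y (frob_if x v) = frob_if (x \<noteq> y) v"
  by (auto simp: frob_if_def frob_frob)

lemma compose_phi_if: "compose (carrier amb) (phi_if y) (phi_if x) = phi_if (x \<noteq> y)"
  by (rule extensionalityI[OF _ phi_if_ext])
    (simp add: compose_def, auto simp: compose_def phi_if_apply inv_if_inv_if frob_if_frob_if)

lemma phi_if_auto: "phi_if x \<in> auto amb"
proof -
  have "phi_if x \<in> hom amb amb"
    by (auto simp: hom_def phi_if_apply inv_if_def frob_if_def W.inv_mult frob_add simp del: add_Pair)
  moreover have "bij_betw (phi_if x) (carrier amb) (carrier amb)"
    by (rule bij_betw_byWitness[where f' = "phi_if x"])
      (auto simp: phi_if_apply inv_if_inv_if frob_if_frob_if, auto simp: inv_if_def frob_if_def)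
  ultimately show ?thesis
    using phi_if_ext by (simp add: auto_def Bij_def)
qed

lemma mult_phi_if: "phi_if x \<otimes>\<^bsub>right_AutoGroup amb\<^esub> phi_if y = phi_if (x \<noteq> y)"
  by (simp only: mult_right_AutoGroup[OF phi_if_auto phi_if_auto] compose_phi_if)

lemma generate_phi: "generate (right_AutoGroup amb) {phi W q} = range phi_if"
proof -
  interpret A: group "right_AutoGroup amb" by (rule group_right_AutoGroup[OF group_amb])
  have one: "phi_if False = \<one>\<^bsub>right_AutoGroup amb\<^esub>" by (simp add: phi_if_def)
  have "subgroup (range phi_if) (right_AutoGroup amb)"
  proof (rule A.subgroupI)
    fix a assume "a \<in> range phi_if"
    then obtain x where a: "a = phi_if x" by auto
    have "inv\<^bsub>right_AutoGroup amb\<^esub> a = phi_if x"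
      unfolding a by (rule A.inv_equality) (use phi_if_auto in \<open>auto simp only: mult_phi_if one carrier_right_AutoGroup simp_thms\<close>)
    then show "inv\<^bsub>right_AutoGroup amb\<^esub> a \<in> range phi_if" by simp
  qed (auto simp: phi_if_auto mult_phi_if)
  then have "generate (right_AutoGroup amb) {phi W q} \<subseteq> range phi_if"
    by (intro A.generate_subgroup_incl) (auto simp: phi_if_def intro: range_eqI[of _ _ True])
  moreover have "phi_if x \<in> generate (right_AutoGroup amb) {phi W q}" for x
    using generate.one[of "right_AutoGroup amb"] by (auto simp: phi_if_def intro: generate.incl)
  ultimately show ?thesis by auto
qed

lemma group_SD: "group SD"
  unfolding phi_semidirect_def
proof (rule group_semidirect[OF group_amb])
  interpret A: group "right_AutoGroup amb" by (rule group_right_AutoGroup[OF group_amb])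
  show "subgroup (generate (right_AutoGroup amb) {phi W q}) (right_AutoGroup amb)"
    using phi_if_auto[of True] by (intro A.generate_is_subgroup) (simp add: phi_if_def)
qed

lemma carrier_SD: "carrier SD = range phi_if \<times> (carrier W \<times> UNIV)"
  by (simp add: phi_semidirect_def semidirect_def generate_phi)

lemma one_SD: "\<one>\<^bsub>SD\<^esub> = (phi_if False, (\<one>\<^bsub>W\<^esub>, 0))"
  by (simp add: phi_semidirect_def semidirect_def phi_if_def)

lemma mult_SD:
  assumes "b \<in> carrier W"
  shows "(phi_if x, (b, v)) \<otimes>\<^bsub>SD\<^esub> (phi_if y, (c, z)) =
    (phi_if (x \<noteq> y), (inv_if y b \<otimes>\<^bsub>W\<^esub> c, frob_if y v + z))"
  using assms by (simp add: phi_semidirect_def semidirect_def mult_phi_if phi_if_apply del: one_right_AutoGroup)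

end

section \<open>The twisted subgroup and its relative difference set\<close>

text \<open>The set \<open>H\<close> is the kernel of a homomorphism from \<open>V\<close> to the group of order two which \<open>\<phi>\<close> preserves;
  the equivalence in \<open>H_add\<close> says this without naming the homomorphism.\<close>

locale hyperplane_twist = inversion_frobenius q W
  for q :: nat and W :: "('w, 'e) monoid_scheme" +
  fixes H :: "('a::{field, finite} \<times> 'a) set"
  assumes H_add: "v + z \<in> H \<longleftrightarrow> (v \<in> H \<longleftrightarrow> z \<in> H)"
    and H_frob: "frob q v \<in> H \<longleftrightarrow> v \<in> H"
begin

definition lift :: "'w \<times> 'a \<times> 'a \<Rightarrow> ('w \<times> 'a \<times> 'a \<Rightarrow> 'w \<times> 'a \<times> 'a) \<times> 'w \<times> 'a \<times> 'a"
  where "lift g = (phi_if (snd g \<notin> H), g)"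

lemma frob_if_H [simp]: "frob_if x v \<in> H \<longleftrightarrow> v \<in> H"
  by (simp add: frob_if_def H_frob)

lemma inj_lift: "inj lift" by (simp add: lift_def inj_def)

lemma lift_eq_iff [simp]: "lift g = lift h \<longleftrightarrow> g = h"
  using inj_lift by (rule inj_eq)

lemma lift_in_image [simp]: "lift g \<in> lift ` S \<longleftrightarrow> g \<in> S"
  using inj_lift by (rule inj_image_mem_iff)

lemma card_lift [simp]: "card (lift ` S) = card S"
  using inj_lift by (simp add: card_image inj_on_subset)

lemma zero_H: "0 \<in> H"
  using H_add[of 0 0] by simp

lemma lift_carrier: "fst g \<in> carrier W \<Longrightarrow> lift g \<in> carrier SD"
  by (cases g) (simp add: carrier_SD lift_def)

lemma lift_one: "lift (\<one>\<^bsub>W\<^esub>, 0) = \<one>\<^bsub>SD\<^esub>"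
  by (simp add: lift_def one_SD zero_H)

text \<open>Lifts multiply to lifts because \<open>\<phi>\<close> preserves membership in \<open>H\<close>, so that being outside \<open>H\<close> is additive
  along the twisted product as well.\<close>

lemma lift_mult:
  assumes "b \<in> carrier W"
  shows "lift (b, v) \<otimes>\<^bsub>SD\<^esub> lift (c, z) =
    lift (inv_if (z \<notin> H) b \<otimes>\<^bsub>W\<^esub> c, frob_if (z \<notin> H) v + z)"
proof -
  have "((v \<notin> H) \<noteq> (z \<notin> H)) = (frob_if (z \<notin> H) v + z \<notin> H)"
    by (auto simp: H_add)
  then show ?thesis
    using assms by (simp only: lift_def snd_conv mult_SD)
qed

lemma lift_inverse:
  assumes "b \<in> carrier W"
  shows "inv\<^bsub>SD\<^esub> (lift (b, v)) = lift (inv_if (v \<notin> H) (inv\<^bsub>W\<^esub> b), frob_if (v \<notin> H) v)"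
proof -
  interpret SD: group SD by (rule group_SD)
  have tt: "inv_if (v \<notin> H) (inv_if (v \<notin> H) (inv\<^bsub>W\<^esub> b)) \<otimes>\<^bsub>W\<^esub> b = \<one>\<^bsub>W\<^esub>"
    using assms by (simp add: inv_if_inv_if) (simp add: inv_if_def)
  have cc: "frob_if (v \<notin> H) (frob_if (v \<notin> H) v) + v = 0"
    by (simp only: frob_if_frob_if) (simp add: frob_if_def)
  show ?thesis
    by (rule SD.inv_equality) (use assms tt cc in \<open>auto simp: lift_mult lift_one intro!: lift_carrier\<close>)
qed

lemma subgroup_lift: "subgroup (lift ` (carrier W \<times> UNIV)) SD"
proof -
  interpret SD: group SD by (rule group_SD)
  show ?thesis
  proof (rule SD.subgroupI)
    show "lift ` (carrier W \<times> UNIV) \<subseteq> carrier SD"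
      by (simp add: image_subset_iff lift_carrier)
  qed (auto simp: lift_mult lift_inverse)
qed

abbreviation lifted where "lifted \<equiv> SD\<lparr>carrier := lift ` (carrier W \<times> UNIV)\<rparr>"

lemma group_lifted: "group lifted"
  by (rule group.subgroup_imp_group[OF group_SD subgroup_lift])

lemma inv_lifted:
  "b \<in> carrier W \<Longrightarrow>
    inv\<^bsub>lifted\<^esub> (lift (b, v)) = lift (inv_if (v \<notin> H) (inv\<^bsub>W\<^esub> b), frob_if (v \<notin> H) v)"
  using group.m_inv_consistent[OF group_SD subgroup_lift, of "lift (b, v)"] lift_inverse by simp

text \<open>In the coordinates \<open>(T, U)\<close> the element \<open>z + frob q z\<close> is \<open>(0, T z)\<close>. So every element with \<open>T = 0\<close>
  has this form, and it is in \<open>H\<close> because \<open>z\<close> and \<open>frob q z\<close> are on the same side of \<open>H\<close>.\<close>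

lemma fixed_space_subset:
  assumes T: "bij (\<lambda>v. (T v :: 'a, U v :: 'a))"
    and add: "\<And>v v'. T (v + v') = T v + T v'" "\<And>v v'. U (v + v') = U v + U v'"
    and frob: "\<And>v. T (frob q v) = T v" "\<And>v. U (frob q v) = U v + T v"
    and "T v = 0"
  shows "v \<in> H"
proof -
  obtain z where z: "T z = U v" "U z = 0"
    using bij_is_surj[OF T] unfolding surj_def by (metis prod.inject)
  have "(T (z + frob q z), U (z + frob q z)) = (T v, U v)"
    using z assms(6) by (simp add: add frob)
  then have "z + frob q z = v"
    using bij_is_inj[OF T] unfolding inj_def by blast
  moreover have "z + frob q z \<in> H"
    by (simp add: H_add H_frob)
  ultimately show ?thesis by simp
qed

text \<open>Here \<open>D\<close> is the union of the labelled lines, and \<open>N\<close> is the line \<open>T = 0\<close> over the identity of \<open>W\<close>. An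
  element \<open>lift (c, z)\<close> with \<open>z \<in> H\<close> translates \<open>D\<close>, and the count is the one for a spread. If \<open>z\<close> is
  outside \<open>H\<close>, the element applies \<open>\<phi>\<close> first. Since \<open>\<phi>\<close> takes \<open>D\<close> to \<open>w\<^sup>-\<^sup>1 D\<close>, this is the translation
  by \<open>(w\<^sup>-\<^sup>1 c, z)\<close> up to relabelling the points of \<open>D\<close> by \<open>b \<mapsto> w b\<^sup>-\<^sup>1\<close>. The exceptional translations,
  those by elements of \<open>N\<close>, do not occur here because \<open>T z = 0\<close> would put \<open>z\<close> into \<open>H\<close>.\<close>

lemma contains_rel_diff_set_lifted:
  assumes order_W: "Coset.order W = q ^ 2"
    and w: "w \<in> carrier W"
    and f: "bij_betw f (carrier W) (UNIV :: 'a set)"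
    and f_refl: "\<And>b. b \<in> carrier W \<Longrightarrow> f (w \<otimes>\<^bsub>W\<^esub> inv\<^bsub>W\<^esub> b) = f b + 1"
  shows "contains_rel_diff_set lifted (q ^ 4) (q ^ 2) (q ^ 4) (q ^ 2)"
proof -
  interpret L: group lifted by (rule group_lifted)
  obtain T U :: "'a \<times> 'a \<Rightarrow> 'a" where
    T_add: "\<And>v v'. T (v + v') = T v + T v'" and U_add: "\<And>v v'. U (v + v') = U v + U v'"
    and bij: "bij (\<lambda>v. (T v, U v))"
    and T_frob: "\<And>v. T (frob q v) = T v" and U_frob: "\<And>v. U (frob q v) = U v + T v"
    using transvection_coordinates by blast
  define V where "V = (\<lambda>t u. inv_into UNIV (\<lambda>v. (T v, U v)) (t, u))"
  have TUV: "(T (V t u), U (V t u)) = (t, u)" for t u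
    using surj_f_inv_f[OF bij_is_surj[OF bij], of "(t, u)"] by (simp add: V_def)
  then have TV [simp]: "T (V t u) = t" and UV [simp]: "U (V t u) = u" for t u
    by auto
  have VTU [simp]: "V (T v) (U v) = v" for v
    using inv_f_f[OF bij_is_inj[OF bij], of v] by (simp add: V_def)
  have V_eq: "V (T v) u = v" if "U v = u" for v u
    using VTU[of v] that by simp
  have T0: "T 0 = 0" and U0: "U 0 = 0"
    using T_add[of 0 0] U_add[of 0 0] by simp_all
  have kernel: "v = 0" if "T v = 0" "U v = 0" for v
    using VTU[of v] VTU[of 0] that T0 U0 by simp
  have kerT: "v \<in> H" if "T v = 0" for v
    by (rule fixed_space_subset[OF bij T_add U_add T_frob U_frob that])
  have finW: "finite (carrier W)"
    using f by (simp add: bij_betw_finite)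
  define D where "D = {(b, v). b \<in> carrier W \<and> U v = f b * T v}"
  define N where "N = {(b, v). b = \<one>\<^bsub>W\<^esub> \<and> T v = 0}"
  have D_sub: "D \<subseteq> carrier W \<times> UNIV" by (auto simp: D_def)
  have N_sub: "N \<subseteq> carrier W \<times> UNIV" by (auto simp: N_def)
  have finD: "finite D"
    by (rule finite_subset[OF D_sub]) (simp add: finW)
  have card_D: "card D = q ^ 4"
  proof -
    have "bij_betw (\<lambda>(b, v). (b, T v)) D (carrier W \<times> UNIV)"
      by (rule bij_betw_byWitness[where f' = "\<lambda>(b, t). (b, V t (f b * t))"])
        (auto simp: D_def V_eq)
    then have "card D = card (carrier W \<times> (UNIV :: 'a set))"
      by (rule bij_betw_same_card)
    then show ?thesis
      using order_W by (simp add: card_cartesian_product card_field Coset.order_def flip: power_add)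
  qed
  have card_N: "card N = q ^ 2"
  proof -
    have "bij_betw (\<lambda>(b, v). U v) N UNIV"
      by (rule bij_betw_byWitness[where f' = "\<lambda>u. (\<one>\<^bsub>W\<^esub>, V 0 u)"])
        (auto simp: N_def, metis VTU)
    then show ?thesis
      by (simp add: bij_betw_same_card card_field)
  qed
  have order: "Coset.order lifted = q ^ 4 * q ^ 2"
    using order_W
    by (simp add: Coset.order_def card_cartesian_product card_field flip: power_add UNIV_Times_UNIV)
  have subgroup_N: "subgroup (lift ` N) lifted"
  proof (rule L.subgroupI)
    show "lift ` N \<subseteq> carrier lifted" using N_sub by auto
    have "(\<one>\<^bsub>W\<^esub>, 0) \<in> N" using T0 by (simp add: N_def)
    then show "lift ` N \<noteq> {}" by blast
    fix a assume "a \<in> lift ` N"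
    then obtain v where a: "a = lift (\<one>\<^bsub>W\<^esub>, v)" and v: "T v = 0" by (auto simp: N_def)
    have "inv\<^bsub>lifted\<^esub> a = lift (\<one>\<^bsub>W\<^esub>, v)"
      unfolding a using kerT[OF v] by (subst inv_lifted) (simp_all add: inv_if_def frob_if_def)
    then show "inv\<^bsub>lifted\<^esub> a \<in> lift ` N" using v by (simp add: N_def)
    fix a' assume "a' \<in> lift ` N"
    then obtain v' where a': "a' = lift (\<one>\<^bsub>W\<^esub>, v')" and v': "T v' = 0" by (auto simp: N_def)
    have "a \<otimes>\<^bsub>lifted\<^esub> a' = lift (\<one>\<^bsub>W\<^esub>, v + v')"
      using kerT[OF v'] by (simp add: a a' lift_mult inv_if_def frob_if_def)
    then show "a \<otimes>\<^bsub>lifted\<^esub> a' \<in> lift ` N" using v v' by (simp add: N_def T_add)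
  qed
  let ?R = "lift ` D"
  have "?R \<subseteq> carrier lifted" using D_sub by auto
  then have inv_R: "m_inv lifted ` ?R \<subseteq> carrier lifted" using L.inv_closed by blast
  have count: "quotient_count lifted (m_inv lifted ` ?R) (lift (c, z)) =
      card {(b, v) \<in> D. (inv_if (z \<notin> H) b \<otimes>\<^bsub>W\<^esub> c, frob_if (z \<notin> H) v + z) \<in> D}"
    if c: "c \<in> carrier W" and ne: "lift (c, z) \<noteq> \<one>\<^bsub>lifted\<^esub>" for c z
  proof -
    let ?M = "{(b, v) \<in> D. (inv_if (z \<notin> H) b \<otimes>\<^bsub>W\<^esub> c, frob_if (z \<notin> H) v + z) \<in> D}"
    have M: "{g \<in> D. lift g \<otimes>\<^bsub>lifted\<^esub> lift (c, z) \<in> ?R} = ?M"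
    proof (rule Collect_cong)
      fix g :: "'w \<times> 'a \<times> 'a"
      obtain b v where g: "g = (b, v)" by (cases g)
      have "b \<in> carrier W" if "(b, v) \<in> D" using that D_sub by auto
      then show "g \<in> D \<and> lift g \<otimes>\<^bsub>lifted\<^esub> lift (c, z) \<in> ?R \<longleftrightarrow> (case g of (b, v) \<Rightarrow>
          (b, v) \<in> D \<and> (inv_if (z \<notin> H) b \<otimes>\<^bsub>W\<^esub> c, frob_if (z \<notin> H) v + z) \<in> D)"
        by (simp add: g lift_mult cong: conj_cong)
    qed
    have "quotient_count lifted (m_inv lifted ` ?R) (lift (c, z)) =
        card {r \<in> ?R. r \<otimes>\<^bsub>lifted\<^esub> lift (c, z) \<in> ?R}"
      using D_sub finD c ne by (intro L.quotient_count_inverses) auto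
    also have "{r \<in> ?R. r \<otimes>\<^bsub>lifted\<^esub> lift (c, z) \<in> ?R} =
        lift ` {g \<in> D. lift g \<otimes>\<^bsub>lifted\<^esub> lift (c, z) \<in> ?R}"
      by blast
    also note M
    also have "card (lift ` ?M) = card ?M"
      by (rule card_lift)
    finally show ?thesis .
  qed
  have count_regular: "quotient_count lifted (m_inv lifted ` ?R) x = q ^ 2"
    if x: "x \<in> carrier lifted - lift ` N" for x
  proof -
    obtain c z where xcz: "x = lift (c, z)" and c: "c \<in> carrier W" using x by auto
    have nN: "c \<noteq> \<one>\<^bsub>W\<^esub> \<or> T z \<noteq> 0" using x xcz by (auto simp: N_def)
    then have ne: "lift (c, z) \<noteq> \<one>\<^bsub>lifted\<^esub>"
      using T0 by (auto simp flip: lift_one)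
    show ?thesis
    proof (cases "z \<in> H")
      case True
      have "bij_betw (\<lambda>(b, v). (b, T v)) {(b, v) \<in> D. (b \<otimes>\<^bsub>W\<^esub> c, v + z) \<in> D}
          {(b, t). b \<in> carrier W \<and> f b * t + U z = f (b \<otimes>\<^bsub>W\<^esub> c) * (t + T z)}"
        by (rule bij_betw_byWitness[where f' = "\<lambda>(b, t). (b, V t (f b * t))"])
          (use c in \<open>auto simp: D_def T_add U_add V_eq\<close>)
      from bij_betw_same_card[OF this] show ?thesis
        using W.card_spread_translate_intersection[OF f c nN]
        by (simp add: xcz count[OF c ne] True inv_if_def frob_if_def card_field)
    next
      case False
      \<comment> \<open>The substitution \<open>b \<mapsto> w b\<^sup>-\<^sup>1\<close> turns \<open>b\<^sup>-\<^sup>1 c\<close> into \<open>b c'\<close> with \<open>c' = w\<^sup>-\<^sup>1 c\<close>, and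
        \<open>f_refl\<close> absorbs the summand \<open>T v\<close> that the automorphism adds to \<open>U v\<close>.\<close>
      define c' where "c' = inv\<^bsub>W\<^esub> w \<otimes>\<^bsub>W\<^esub> c"
      have c': "c' \<in> carrier W" using w c by (simp add: c'_def)
      have cancel: "w \<otimes>\<^bsub>W\<^esub> (inv\<^bsub>W\<^esub> w \<otimes>\<^bsub>W\<^esub> b) = b" if "b \<in> carrier W" for b
        using that w by (simp flip: W.m_assoc)
      have shift: "inv\<^bsub>W\<^esub> b \<otimes>\<^bsub>W\<^esub> c = w \<otimes>\<^bsub>W\<^esub> inv\<^bsub>W\<^esub> b \<otimes>\<^bsub>W\<^esub> c'" if "b \<in> carrier W" for b
      proof -
        have "w \<otimes>\<^bsub>W\<^esub> inv\<^bsub>W\<^esub> b \<otimes>\<^bsub>W\<^esub> c' = inv\<^bsub>W\<^esub> b \<otimes>\<^bsub>W\<^esub> (w \<otimes>\<^bsub>W\<^esub> (inv\<^bsub>W\<^esub> w \<otimes>\<^bsub>W\<^esub> c))"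
          using that w c by (simp add: c'_def W.m_assoc W.m_lcomm[of w "inv\<^bsub>W\<^esub> b"])
        then show ?thesis using cancel[OF c] by simp
      qed
      have refl2: "w \<otimes>\<^bsub>W\<^esub> inv\<^bsub>W\<^esub> (w \<otimes>\<^bsub>W\<^esub> inv\<^bsub>W\<^esub> b) = b" if "b \<in> carrier W" for b
        using that w by (simp add: W.inv_mult cancel)
      have "T z \<noteq> 0" using False kerT[of z] by blast
      have "bij_betw (\<lambda>(b, v). (w \<otimes>\<^bsub>W\<^esub> inv\<^bsub>W\<^esub> b, T v))
          {(b, v) \<in> D. (inv\<^bsub>W\<^esub> b \<otimes>\<^bsub>W\<^esub> c, frob q v + z) \<in> D}
          {(b, t). b \<in> carrier W \<and> f b * t + U z = f (b \<otimes>\<^bsub>W\<^esub> c') * (t + T z)}"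
        by (rule bij_betw_byWitness
              [where f' = "\<lambda>(b, t). (w \<otimes>\<^bsub>W\<^esub> inv\<^bsub>W\<^esub> b, V t (f (w \<otimes>\<^bsub>W\<^esub> inv\<^bsub>W\<^esub> b) * t))"])
          (use c w in \<open>auto simp: D_def T_add U_add T_frob U_frob shift refl2 f_refl algebra_simps V_eq\<close>)
      from bij_betw_same_card[OF this] show ?thesis
        using W.card_spread_translate_intersection[OF f c', of "T z" "U z"] \<open>T z \<noteq> 0\<close>
        by (simp add: xcz count[OF c ne] False inv_if_def frob_if_def card_field)
    qed
  qed
  have count_forbidden: "quotient_count lifted (m_inv lifted ` ?R) x = 0" if x: "x \<in> lift ` N" for x
  proof (cases "x = \<one>\<^bsub>lifted\<^esub>")
    case True
    have "r \<otimes>\<^bsub>lifted\<^esub> inv\<^bsub>lifted\<^esub> s \<noteq> \<one>\<^bsub>lifted\<^esub>" if "r \<noteq> s" "r \<in> carrier lifted" "s \<in> carrier lifted" for r s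
      using that L.inv_equality L.inv_solve_right' L.l_one L.one_closed by metis
    then have "{(r1, r2) \<in> (m_inv lifted ` ?R) \<times> (m_inv lifted ` ?R). r1 \<noteq> r2 \<and>
        r1 \<otimes>\<^bsub>lifted\<^esub> inv\<^bsub>lifted\<^esub> r2 = x} = {}"
      using inv_R unfolding True by blast
    then show ?thesis unfolding quotient_count_def by (simp only: card.empty)
  next
    case False
    obtain z where xz: "x = lift (\<one>\<^bsub>W\<^esub>, z)" and z: "T z = 0" using x by (auto simp: N_def)
    have "z \<noteq> 0" using False xz by (auto simp: lift_one)
    then have "U z \<noteq> 0" using kernel[of z] z by blast
    then have empty: "{(b, v) \<in> D. (b \<otimes>\<^bsub>W\<^esub> \<one>\<^bsub>W\<^esub>, v + z) \<in> D} = {}"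
      using z by (auto simp: D_def T_add U_add)
    have "quotient_count lifted (m_inv lifted ` ?R) x =
        card {(b, v) \<in> D. (b \<otimes>\<^bsub>W\<^esub> \<one>\<^bsub>W\<^esub>, v + z) \<in> D}"
      using count[of "\<one>\<^bsub>W\<^esub>" z] False kerT[OF z] by (simp add: xz inv_if_def frob_if_def)
    then show ?thesis
      by (simp only: empty card.empty)
  qed
  have "rel_diff_set lifted (q ^ 4) (q ^ 2) (q ^ 4) (q ^ 2) (lift ` N) (m_inv lifted ` ?R)"
    unfolding rel_diff_set_def
  proof (intro conjI ballI)
    show "finite (carrier lifted)" using finW by simp
    show "card (lift ` N) = q ^ 2"
      using card_N by simp
    show "m_inv lifted ` ?R \<subseteq> carrier lifted" by (rule inv_R)
    have "inj_on (m_inv lifted) ?R"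
      by (rule inj_on_subset[OF L.inv_inj]) (use D_sub in auto)
    then show "card (m_inv lifted ` ?R) = q ^ 4"
      using card_D by (simp add: card_image)
  qed (use L.is_group subgroup_N order count_regular count_forbidden in auto)
  then show ?thesis unfolding contains_rel_diff_set_def by blast
qed

end

section \<open>The subgroup generated by a basis\<close>

lemma (in quadratic_frobenius) vector_space_bit_scale:
  "vector_space (bit_scale :: bit \<Rightarrow> 'a \<times> 'a \<Rightarrow> 'a \<times> 'a)"
proof
  show "bit_scale (a + b) x = bit_scale a x + bit_scale b x" for a b and x :: "'a \<times> 'a"
    by (cases a; cases b) (simp_all add: bit_scale_def)
qed (auto simp: bit_scale_def)

context inversion_frobenius
begin

text \<open>As \<open>B\<close> misses only \<open>b0\<close> of a basis over the field with two elements, its span has exactly the two cosets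
  represented by \<open>0\<close> and \<open>b0\<close>.\<close>

lemma span_invariant_hyperplane:
  fixes B :: "('a \<times> 'a) set"
  assumes basis: "GF2_basis (insert b0 B)" and b0: "b0 \<notin> B"
    and inv: "frob q ` module.span bit_scale B \<subseteq> module.span bit_scale B"
  shows "hyperplane_twist q W (module.span bit_scale B)" and "b0 \<notin> module.span bit_scale B"
proof -
  interpret vector_space "bit_scale :: bit \<Rightarrow> 'a \<times> 'a \<Rightarrow> 'a \<times> 'a"
    by (rule vector_space_bit_scale)
  show b0': "b0 \<notin> span B"
    using basis b0 by (simp add: GF2_basis_def independent_insert)
  have coset: "v + b0 \<in> span B" if "v \<notin> span B" for v
  proof -
    have "v \<in> span (insert b0 B)" using basis by (simp add: GF2_basis_def)
    then obtain k where "v - bit_scale k b0 \<in> span B"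
      by (auto simp: span_insert)
    moreover have "v - b0 = v + b0" by (cases v; cases b0) simp
    ultimately show ?thesis using that by (cases "k = 1") (auto simp: bit_scale_def)
  qed
  have add: "v + z \<in> span B \<longleftrightarrow> (v \<in> span B \<longleftrightarrow> z \<in> span B)" for v z
  proof (cases "v \<in> span B \<or> z \<in> span B")
    case True
    then show ?thesis
      by (metis span_add span_add_eq span_add_eq2)
  next
    case False
    then have "(v + b0) + (z + b0) \<in> span B" by (intro span_add coset) auto
    moreover have "(v + b0) + (z + b0) = v + z" by (simp add: add_ac)
    ultimately show ?thesis using False by simp
  qed
  have "frob q v \<in> span B \<longleftrightarrow> v \<in> span B" for v
    using inv frob_frob[of v] by (metis image_subset_iff)
  then show "hyperplane_twist q W (span B)"
    by unfold_locales (use add in auto)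
qed

text \<open>The generators are lifts, and the lifts form a subgroup. Conversely the generators \<open>(1, 1, s, t)\<close> and
  \<open>(1, w, 0, 0)\<close> give all lifts of elements with \<open>v \<in> H\<close>, and the generator involving \<open>\<phi>\<close> gives the rest,
  as its vector \<open>(\<beta>, 0)\<close> represents the other coset.\<close>

lemma calG_set_eq_lift:
  fixes B :: "('a \<times> 'a) set"
  assumes basis: "GF2_basis (insert (\<beta>, 0) B)" and b0: "(\<beta>, 0) \<notin> B"
    and inv: "frob q ` module.span bit_scale B \<subseteq> module.span bit_scale B"
    and w: "w \<in> carrier W" "carrier W = generate W {w}"
  shows "calG_set W q w \<beta> B =
    hyperplane_twist.lift q W (module.span bit_scale B) ` (carrier W \<times> UNIV)"
proof -
  interpret V: vector_space "bit_scale :: bit \<Rightarrow> 'a \<times> 'a \<Rightarrow> 'a \<times> 'a"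
    by (rule vector_space_bit_scale)
  interpret H: hyperplane_twist q W "V.span B"
    by (rule span_invariant_hyperplane[OF basis b0 inv])
  have bH: "(\<beta>, 0) \<notin> V.span B"
    by (rule span_invariant_hyperplane[OF basis b0 inv])
  interpret SD: group SD by (rule group_SD)
  let ?X = "{H.lift (\<one>\<^bsub>W\<^esub>, (\<beta>, 0)), H.lift (w, 0)} \<union> (\<lambda>v. H.lift (\<one>\<^bsub>W\<^esub>, v)) ` B"
  have B_span: "v \<in> V.span B" if "v \<in> B" for v
    using that by (rule V.span_base)
  have "calG_set W q w \<beta> B = generate SD ?X"
    unfolding calG_set_def
    by (rule arg_cong[where f = "generate SD"])
      (use bH B_span H.zero_H in \<open>auto simp: H.lift_def phi_if_def image_iff zero_prod_def\<close>)
  also have "generate SD ?X = H.lift ` (carrier W \<times> UNIV)" (is "?K = _")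
  proof
    show "?K \<subseteq> H.lift ` (carrier W \<times> UNIV)"
      using w(1) by (intro SD.generate_subgroup_incl H.subgroup_lift) auto
    interpret K: subgroup ?K SD
      using w(1) by (intro SD.generate_is_subgroup) (simp add: image_subset_iff H.lift_carrier)
    have Xb: "H.lift (\<one>\<^bsub>W\<^esub>, (\<beta>, 0)) \<in> ?K" and Xw: "H.lift (w, 0) \<in> ?K"
      by (blast intro: generate.incl)+
    have XB: "H.lift (\<one>\<^bsub>W\<^esub>, v) \<in> ?K" if "v \<in> B" for v
      using that by (blast intro: generate.incl)
    have first: "H.lift (b, 0) \<in> ?K" if "b \<in> generate W {w}" for b
      using that
    proof (induction rule: generate.induct)
      case one
      then show ?case using K.one_closed by (simp add: H.lift_one)
    next
      case (incl h)
      then show ?case using Xw by simp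
    next
      case (inv h)
      then have "H.lift (h, 0) \<in> ?K" "h \<in> carrier W" using w(1) Xw by auto
      then show ?case
        using K.m_inv_closed[of "H.lift (h, 0)"] H.lift_inverse[of h 0] H.zero_H by (simp add: inv_if_def frob_if_def)
    next
      case (eng h1 h2)
      then have "h1 \<in> carrier W" using w(2) by simp
      then show ?case
        using K.m_closed[OF eng.IH] H.lift_mult[of h1 0 h2 0] H.zero_H
        by (simp add: inv_if_def frob_if_def)
    qed
    have second: "v \<in> V.span B \<and> H.lift (\<one>\<^bsub>W\<^esub>, v) \<in> ?K" if "v \<in> V.span B" for v
      using that
    proof (induction rule: V.span_induct_alt)
      case base
      then show ?case using K.one_closed H.zero_H by (simp add: H.lift_one)
    next
      case (step c x y)
      show ?case
      proof (cases "c = 1")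
        case True
        then have sc: "bit_scale c x = x" by (simp add: bit_scale_def)
        have "H.lift (\<one>\<^bsub>W\<^esub>, x) \<otimes>\<^bsub>SD\<^esub> H.lift (\<one>\<^bsub>W\<^esub>, y) \<in> ?K"
          by (rule K.m_closed[OF XB[OF step(1)] conjunct2[OF step(2)]])
        then show ?thesis
          using step B_span by (simp add: sc H.lift_mult inv_if_def frob_if_def V.span_add)
      next
        case False
        then have sc: "bit_scale c x = 0" by (simp add: bit_scale_def)
        show ?thesis using step(2) by (simp only: sc add_0)
      qed
    qed
    have even: "H.lift (b, v) \<in> ?K" if "b \<in> carrier W" "v \<in> V.span B" for b v
      using K.m_closed[of "H.lift (b, 0)" "H.lift (\<one>\<^bsub>W\<^esub>, v)"] first second that w(2)
      by (simp add: H.lift_mult inv_if_def frob_if_def)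
    have "H.lift (b, v) \<in> ?K" if b: "b \<in> carrier W" for b v
    proof (cases "v \<in> V.span B")
      case False
      then have "v + (\<beta>, 0) \<in> V.span B" using bH H.H_add by blast
      moreover have e: "(\<beta>, 0) + (v + (\<beta>, 0)) = v" by (subst add.left_commute) simp
      ultimately show ?thesis
        using K.m_closed[OF Xb even, of b "v + (\<beta>, 0)"] b
        by (simp add: e H.lift_mult inv_if_def frob_if_def)
    qed (use b even in simp)
    then show "H.lift ` (carrier W \<times> UNIV) \<subseteq> ?K" by auto
  qed
  finally show ?thesis .
qed

end

theorem theorem8p2:
  fixes d q :: nat
    and W :: "('w, 'e) monoid_scheme"
    and w :: 'w
    and F :: "'a::{field, finite} set"
    and \<beta> :: 'a
    and B :: "('a \<times> 'a) set"
  assumes "d > 0"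
    and "q = 2 ^ d"
    and "card (UNIV :: 'a set) = q ^ 2"
    and "subfield F (ring_of_type_algebra :: 'a ring)"
    and "card F = q"
    and "group W"
    and "w \<in> carrier W"
    and "carrier W = generate W {w}"
    and "Coset.order W = q ^ 2"
    and "\<beta> \<notin> F"
    and "GF2_basis (B \<union> {(\<beta>, 0)})"
    and "(\<beta>, 0) \<notin> B"
    and "frob q ` module.span bit_scale B \<subseteq> module.span bit_scale B"
  shows "subgroup (calG_set W q w \<beta> B) (phi_semidirect W q)
    \<and> group (calG W q w \<beta> B)
    \<and> \<not> comm_group (calG W q w \<beta> B)
    \<and> contains_rel_diff_set (calG W q w \<beta> B) (q ^ 4) (q ^ 2) (q ^ 4) (q ^ 2)"
proof -
  interpret Q: quadratic_frobenius q
    by (rule quadratic_frobenius_two_power) (use assms in auto)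
  interpret W: group W by fact
  have q2: "even (q ^ 2)" "q ^ 2 > 2"
  proof -
    show "even (q ^ 2)" using assms(1,2) by simp
    have "2 * 2 \<le> q * q" using Q.q_gt_1 by (intro mult_le_mono) auto
    then show "q ^ 2 > 2" by (simp add: power2_eq_square)
  qed
  have finW: "finite (carrier W)"
    using Q.q_gt_1 assms(9) by (simp flip: W.order_gt_0_iff_finite)
  have "comm_group W"
    using assms(7,8) by (rule W.comm_group_of_generator)
  then interpret inversion_frobenius q W
    by (simp add: inversion_frobenius_def Q.quadratic_frobenius_axioms)
  have basis: "GF2_basis (insert (\<beta>, 0) B)" using assms(11) by simp
  interpret H: hyperplane_twist q W "module.span bit_scale B"
    by (rule span_invariant_hyperplane[OF basis assms(12,13)])
  have bH: "(\<beta>, 0) \<notin> module.span bit_scale B"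
    by (rule span_invariant_hyperplane[OF basis assms(12,13)])
  have set: "calG_set W q w \<beta> B = H.lift ` (carrier W \<times> UNIV)"
    by (rule calG_set_eq_lift[OF basis assms(12,13,7,8)])
  then have calG: "calG W q w \<beta> B = H.lifted" by (simp add: calG_def)
  obtain f where f: "bij_betw f (carrier W) (UNIV :: 'a set)"
    and f_refl: "\<And>b. b \<in> carrier W \<Longrightarrow> f (w \<otimes>\<^bsub>W\<^esub> inv\<^bsub>W\<^esub> b) = f b + 1"
  proof (rule W.cyclic_reflection_labelling[OF assms(7,8) finW, of "UNIV :: 'a set" "\<lambda>a. a + 1"])
  qed (use q2 assms(3,9) in \<open>auto simp: add.assoc\<close>)
  have "\<not> comm_group H.lifted"
  proof
    assume "comm_group H.lifted"
    then interpret L: comm_group H.lifted .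
    have "H.lift (\<one>\<^bsub>W\<^esub>, (\<beta>, 0)) \<otimes>\<^bsub>H.lifted\<^esub> H.lift (w, 0) =
        H.lift (w, 0) \<otimes>\<^bsub>H.lifted\<^esub> H.lift (\<one>\<^bsub>W\<^esub>, (\<beta>, 0))"
      using assms(7) by (intro L.m_comm) auto
    then have "H.lift (w, (\<beta>, 0)) = H.lift (inv\<^bsub>W\<^esub> w, (\<beta>, 0))"
      using assms(7) bH H.zero_H by (simp add: H.lift_mult inv_if_def frob_if_def frob_def)
    then have "w = inv\<^bsub>W\<^esub> w" by simp
    then have "w [^]\<^bsub>W\<^esub> (2::nat) = \<one>\<^bsub>W\<^esub>"
      using W.r_inv[OF assms(7)] assms(7) by (simp add: numeral_2_eq_2)
    then have "W.ord w dvd 2"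
      using assms(7) by (simp add: W.pow_eq_id)
    moreover have "W.ord w = q ^ 2"
      using W.generate_pow_card[OF assms(7)] assms(8,9) by (simp add: Coset.order_def)
    ultimately show False
      using q2 by (auto dest: dvd_imp_le)
  qed
  then show ?thesis
    using H.subgroup_lift H.group_lifted H.contains_rel_diff_set_lifted[OF assms(9,7) f f_refl]
    by (simp only: set calG) simp
qed

end
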